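(* Let $R$ be a commutative ring and $G$ a finite edge-labeled graph over $R$. There are canonical exact sequences of $R$-modules $$0\longrightarrow R_G\longrightarrow R^V\xrightarrow{\ \overline{\rho_G}\ }\overline{R_G}\longrightarrow 0$$ and $$0\longrightarrow \overline{R_G}\longrightarrow R^E\xrightarrow{\ \underline{\rho_G}\ }\underline{R_G}\longrightarrow 0,$$ where $R_G\to R^V$ and $\overline{R_G}\to R^E$ are the inclusions.
   Context: A finite edge-labeled graph $G=(G,\alpha)$ over a commutative ring $R$ consists of a finite graph with vertex set $V$ and edge set $E$, with an arbitrary fixed orientation of the edges, together with a function $\alpha$ assigning to each edge $e\in E$ an ideal $I_e:=\alpha(e)$ of $R$. Put $R^V:=\bigoplus_{v\in V}R$ and $R^E:=\bigoplus_{e\in E}R/I_e$. The potential morphism $\rho_G:R^V\to R^E$ is the $R$-linear map sending $(r_v)_{v\in V}$ to the tuple whose component at an edge $e=e_{uv}$ (oriented using the fixed orientation) is the class of $r_u-r_v$ in $R/I_e$. Define: - $R_G:=\ker(\rho_G)$ (generalized splines); - $\overline{R_G}:=\operatorname{im}(\rho_G)\subseteq R^E$ (generalized cosplines), and $\overline{\rho_G}:R^V\to\overline{R_G}$ the map induced by $\rho_G$; - $\underline{R_G}:=R^E/\overline{R_G}$ (failed cosplines), and $\underline{\rho_G}:R^E\to\underline{R_G}$ the quotient map (copotential morphism). *)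

theory Defs
  imports "HOL-Algebra.Algebra" "Graph_Theory.Digraph"
begin

section \<open>Modules: constructions and exactness\<close>

text \<open>The locale \<^locale>\<open>module\<close> does not refer to the multiplicative fields \<open>mult\<close> and \<open>one\<close>
  that the record type of modules inherits from rings; they carry no information below.\<close>

definition regular_module :: "('a, 'm) ring_scheme \<Rightarrow> ('a, 'a) module" where
  "regular_module R =
     \<lparr>carrier = carrier R, monoid.mult = (\<otimes>\<^bsub>R\<^esub>), one = \<one>\<^bsub>R\<^esub>,
      ring.zero = \<zero>\<^bsub>R\<^esub>, ring.add = (\<oplus>\<^bsub>R\<^esub>),
      module.smult = (\<otimes>\<^bsub>R\<^esub>)\<rparr>"

definition zero_module :: "('a, unit) module" where
  "zero_module =
     \<lparr>carrier = {()}, monoid.mult = (\<lambda>_ _. ()), one = (), ring.zero = (), ring.add = (\<lambda>_ _. ()),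
      module.smult = (\<lambda>_ _. ())\<rparr>"

definition direct_sum_module :: "'i set \<Rightarrow> ('i \<Rightarrow> ('a, 'b) module) \<Rightarrow> ('a, 'i \<Rightarrow> 'b) module" where
  "direct_sum_module I M =
     \<lparr>carrier = {x \<in> \<Pi>\<^sub>E i\<in>I. carrier (M i). finite {i \<in> I. x i \<noteq> \<zero>\<^bsub>M i\<^esub>}},
      monoid.mult = undefined, one = undefined,
      ring.zero = (\<lambda>i\<in>I. \<zero>\<^bsub>M i\<^esub>),
      ring.add = (\<lambda>x y. \<lambda>i\<in>I. x i \<oplus>\<^bsub>M i\<^esub> y i),
      module.smult = (\<lambda>r x. \<lambda>i\<in>I. r \<odot>\<^bsub>M i\<^esub> x i)\<rparr>"

text \<open>The quotient of \<open>M\<close> by a submodule \<open>N\<close>. Scalars act on cosets by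
  \<open>r (N + x) = N + r x\<close>, written as a union over the representatives \<open>x\<close> as in
  \<^const>\<open>rcoset_mult\<close>.\<close>

definition quotient_module :: "('a, 'b) module \<Rightarrow> 'b set \<Rightarrow> ('a, 'b set) module" where
  "quotient_module M N =
     \<lparr>carrier = a_rcosets\<^bsub>M\<^esub> N, monoid.mult = undefined, one = undefined, ring.zero = N,
      ring.add = set_add M,
      module.smult = (\<lambda>r A. \<Union>x\<in>A. N +>\<^bsub>M\<^esub> (r \<odot>\<^bsub>M\<^esub> x))\<rparr>"

lemma quotient_regular_module_eq_Quot:
  "carrier (quotient_module (regular_module R) I) = carrier (R Quot I)"
  "(\<oplus>\<^bsub>quotient_module (regular_module R) I\<^esub>) = (\<oplus>\<^bsub>R Quot I\<^esub>)"
  "\<zero>\<^bsub>quotient_module (regular_module R) I\<^esub> = \<zero>\<^bsub>R Quot I\<^esub>"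
  by (auto simp: quotient_module_def regular_module_def FactRing_def A_RCOSETS_def RCOSETS_def
      r_coset_def set_add_def set_mult_def fun_eq_iff)

definition mod_hom ::
  "('a, 'm) ring_scheme \<Rightarrow> ('a, 'b) module \<Rightarrow> ('a, 'c) module \<Rightarrow> ('b \<Rightarrow> 'c) set" where
  "mod_hom R M N =
     {f \<in> carrier M \<rightarrow> carrier N.
        (\<forall>x \<in> carrier M. \<forall>y \<in> carrier M. f (x \<oplus>\<^bsub>M\<^esub> y) = f x \<oplus>\<^bsub>N\<^esub> f y) \<and>
        (\<forall>r \<in> carrier R. \<forall>x \<in> carrier M. f (r \<odot>\<^bsub>M\<^esub> x) = r \<odot>\<^bsub>N\<^esub> f x)}"

definition exact_at ::
  "('a, 'm) ring_scheme \<Rightarrow> ('a, 'b) module \<Rightarrow> ('b \<Rightarrow> 'c) \<Rightarrow> ('a, 'c) module \<Rightarrow>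
     ('c \<Rightarrow> 'd) \<Rightarrow> ('a, 'd) module \<Rightarrow> bool" where
  "exact_at R A f B g C \<longleftrightarrow>
     module R A \<and> module R B \<and> module R C \<and>
     f \<in> mod_hom R A B \<and> g \<in> mod_hom R B C \<and>
     f ` carrier A = a_kernel B C g"

definition short_exact_seq ::
  "('a, 'm) ring_scheme \<Rightarrow> ('a, 'b) module \<Rightarrow> ('b \<Rightarrow> 'c) \<Rightarrow> ('a, 'c) module \<Rightarrow>
     ('c \<Rightarrow> 'd) \<Rightarrow> ('a, 'd) module \<Rightarrow> bool" where
  "short_exact_seq R A f B g C \<longleftrightarrow>
     exact_at R zero_module (\<lambda>_. \<zero>\<^bsub>A\<^esub>) A f B \<and>
     exact_at R A f B g C \<and>
     exact_at R B g C (\<lambda>_. ()) zero_module"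

section \<open>Edge-labeled graphs\<close>

text \<open>A finite graph with a fixed orientation of its edges is a finite digraph: the edge \<open>e\<close>
  is oriented from \<open>tail G e\<close> to \<open>head G e\<close>. Loops and parallel edges are allowed.\<close>

locale edge_labeled_graph = R?: cring R + fin_digraph G
  for R :: "('a, 'm) ring_scheme" (structure)
    and G :: "('v, 'e) pre_digraph"
    and \<alpha> :: "'e \<Rightarrow> 'a set" +
  assumes label_ideal: "e \<in> arcs G \<Longrightarrow> ideal (\<alpha> e) R"

definition vertex_module ::
  "('a, 'm) ring_scheme \<Rightarrow> ('v, 'e) pre_digraph \<Rightarrow> ('a, 'v \<Rightarrow> 'a) module" where
  "vertex_module R G = direct_sum_module (verts G) (\<lambda>_. regular_module R)"

definition edge_module ::
  "('a, 'm) ring_scheme \<Rightarrow> ('v, 'e) pre_digraph \<Rightarrow> ('e \<Rightarrow> 'a set) \<Rightarrow> ('a, 'e \<Rightarrow> 'a set) module" where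
  "edge_module R G \<alpha> =
     direct_sum_module (arcs G) (\<lambda>e. quotient_module (regular_module R) (\<alpha> e))"

text \<open>The morphism induced by the potential morphism on its image is the same function; only the
  codomain passed to \<^const>\<open>mod_hom\<close> changes.\<close>

definition potential ::
  "('a, 'm) ring_scheme \<Rightarrow> ('v, 'e) pre_digraph \<Rightarrow> ('e \<Rightarrow> 'a set) \<Rightarrow> ('v \<Rightarrow> 'a) \<Rightarrow> 'e \<Rightarrow> 'a set" where
  "potential R G \<alpha> r = (\<lambda>e\<in>arcs G. \<alpha> e +>\<^bsub>R\<^esub> (r (tail G e) \<ominus>\<^bsub>R\<^esub> r (head G e)))"

definition spline_module ::
  "('a, 'm) ring_scheme \<Rightarrow> ('v, 'e) pre_digraph \<Rightarrow> ('e \<Rightarrow> 'a set) \<Rightarrow> ('a, 'v \<Rightarrow> 'a) module" where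
  "spline_module R G \<alpha> = (vertex_module R G)
     \<lparr>carrier := a_kernel (vertex_module R G) (edge_module R G \<alpha>) (potential R G \<alpha>)\<rparr>"

definition cospline_module ::
  "('a, 'm) ring_scheme \<Rightarrow> ('v, 'e) pre_digraph \<Rightarrow> ('e \<Rightarrow> 'a set) \<Rightarrow> ('a, 'e \<Rightarrow> 'a set) module" where
  "cospline_module R G \<alpha> = (edge_module R G \<alpha>)
     \<lparr>carrier := potential R G \<alpha> ` carrier (vertex_module R G)\<rparr>"

definition failed_cospline_module ::
  "('a, 'm) ring_scheme \<Rightarrow> ('v, 'e) pre_digraph \<Rightarrow> ('e \<Rightarrow> 'a set) \<Rightarrow>
     ('a, ('e \<Rightarrow> 'a set) set) module" where
  "failed_cospline_module R G \<alpha> =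
     quotient_module (edge_module R G \<alpha>) (carrier (cospline_module R G \<alpha>))"

definition copotential ::
  "('a, 'm) ring_scheme \<Rightarrow> ('v, 'e) pre_digraph \<Rightarrow> ('e \<Rightarrow> 'a set) \<Rightarrow>
     ('e \<Rightarrow> 'a set) \<Rightarrow> ('e \<Rightarrow> 'a set) set" where
  "copotential R G \<alpha> y = carrier (cospline_module R G \<alpha>) +>\<^bsub>edge_module R G \<alpha>\<^esub> y"

end

theory Submission
  imports Defs
begin

text \<open>Both sequences are instances of general facts about modules. A homomorphism \<open>f : M \<rightarrow> N\<close>
  factors as a surjection onto its image whose kernel is \<open>ker f\<close>, and a submodule \<open>P\<close> of \<open>N\<close>
  is the kernel of the surjection \<open>N \<rightarrow> N/P\<close>
  (\<open>short_exact_seq_kernel_image\<close>, \<open>short_exact_seq_quotient\<close>). The first is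
  applied to the potential morphism, the second to its image inside the edge module.

  What has to be checked about the graph is therefore only that the vertex and edge modules are
  modules and that the potential morphism is linear. The former holds because the regular module,
  quotients and direct sums of modules are modules. The latter reduces to the components:
  as there are only finitely many edges, a family of linear maps indexed by them is a linear map
  into the direct sum (\<open>mod_hom_into_direct_sum\<close>), and the component at an edge is a difference of
  two coordinates followed by a quotient map.\<close>

section \<open>Homomorphisms, kernels and images\<close>

lemma mod_homI:
  assumes "\<And>x. x \<in> carrier M \<Longrightarrow> f x \<in> carrier N"
    and "\<And>x y. x \<in> carrier M \<Longrightarrow> y \<in> carrier M \<Longrightarrow> f (x \<oplus>\<^bsub>M\<^esub> y) = f x \<oplus>\<^bsub>N\<^esub> f y"
    and "\<And>r x. r \<in> carrier R \<Longrightarrow> x \<in> carrier M \<Longrightarrow> f (r \<odot>\<^bsub>M\<^esub> x) = r \<odot>\<^bsub>N\<^esub> f x"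
  shows "f \<in> mod_hom R M N"
  using assms by (auto simp: mod_hom_def)

lemma mod_homD:
  assumes "f \<in> mod_hom R M N"
  shows "x \<in> carrier M \<Longrightarrow> f x \<in> carrier N"
    and "x \<in> carrier M \<Longrightarrow> y \<in> carrier M \<Longrightarrow> f (x \<oplus>\<^bsub>M\<^esub> y) = f x \<oplus>\<^bsub>N\<^esub> f y"
    and "r \<in> carrier R \<Longrightarrow> x \<in> carrier M \<Longrightarrow> f (r \<odot>\<^bsub>M\<^esub> x) = r \<odot>\<^bsub>N\<^esub> f x"
  using assms by (auto simp: mod_hom_def)

lemma mod_hom_comp:
  assumes "f \<in> mod_hom R L M" "g \<in> mod_hom R M N"
  shows "(\<lambda>x. g (f x)) \<in> mod_hom R L N"
  by (rule mod_homI) (simp_all add: mod_homD[OF assms(1)] mod_homD[OF assms(2)])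

lemma abelian_group_hom_of_mod_hom:
  assumes M: "module R M" and N: "module R N" and f: "f \<in> mod_hom R M N"
  shows "abelian_group_hom M N f"
proof -
  interpret M: module R M by fact
  interpret N: module R N by fact
  show ?thesis
    by (intro abelian_group_homI M.abelian_group_axioms N.abelian_group_axioms
        group_hom.intro group_hom_axioms.intro M.a_group N.a_group)
      (auto simp: hom_def mod_homD[OF f])
qed

lemma submodule_kernel:
  assumes M: "module R M" and N: "module R N" and f: "f \<in> mod_hom R M N"
  shows "submodule (a_kernel M N f) R M"
proof -
  interpret M: module R M by fact
  interpret N: module R N by fact
  note hom = abelian_group_hom_of_mod_hom[OF assms]
  note hom_simps = abelian_group_hom.hom_zero[OF hom] abelian_group_hom.hom_a_inv[OF hom]
    mod_homD[OF f]
  show ?thesis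
    by (rule M.submoduleI) (auto simp: a_kernel_def' hom_simps)
qed

lemma submodule_image:
  assumes M: "module R M" and N: "module R N" and f: "f \<in> mod_hom R M N"
  shows "submodule (f ` carrier M) R N"
proof -
  interpret M: module R M by fact
  interpret N: module R N by fact
  note hom = abelian_group_hom_of_mod_hom[OF assms]
  note hom_simps = abelian_group_hom.hom_zero[OF hom] abelian_group_hom.hom_a_inv[OF hom]
    mod_homD[OF f]
  show ?thesis
  proof (rule N.submoduleI)
    show "\<zero>\<^bsub>N\<^esub> \<in> f ` carrier M"
      by (rule image_eqI[of _ _ "\<zero>\<^bsub>M\<^esub>"]) (simp_all add: hom_simps)
    show "\<ominus>\<^bsub>N\<^esub> a \<in> f ` carrier M" if "a \<in> f ` carrier M" for a
      using that by (auto simp flip: hom_simps(2,4,5))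
    show "a \<oplus>\<^bsub>N\<^esub> b \<in> f ` carrier M" if "a \<in> f ` carrier M" "b \<in> f ` carrier M" for a b
      using that by (auto simp flip: hom_simps(2,4,5))
    show "r \<odot>\<^bsub>N\<^esub> a \<in> f ` carrier M" if "r \<in> carrier R" "a \<in> f ` carrier M" for r a
      using that by (auto simp flip: hom_simps(2,4,5))
  qed (auto simp: hom_simps)
qed

text \<open>The module axioms are closure conditions, equations and the existence of negatives, and
  all of these pass along a surjection that respects the operations. For quotients this replaces computations
  with cosets by computations with representatives.\<close>

lemma module_of_surjection:
  assumes M: "module R M"
    and surj: "f ` carrier M = carrier N"
    and zero: "f \<zero>\<^bsub>M\<^esub> = \<zero>\<^bsub>N\<^esub>"
    and f: "f \<in> mod_hom R M N"
  shows "module R N"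
proof -
  interpret M: module R M by fact
  note hom = mod_homD(2,3)[OF f, symmetric]
  have repr: "\<exists>a \<in> carrier M. x = f a" if "x \<in> carrier N" for x
    using that surj by blast
  show ?thesis
  proof (rule moduleI)
    show "cring R" ..
    show "abelian_group N"
    proof (rule abelian_groupI)
      show "\<zero>\<^bsub>N\<^esub> \<in> carrier N"
        using mod_homD(1)[OF f M.zero_closed] by (simp add: zero)
      fix x y z assume x: "x \<in> carrier N" and y: "y \<in> carrier N" and z: "z \<in> carrier N"
      obtain a b c where *: "a \<in> carrier M" "b \<in> carrier M" "c \<in> carrier M"
        "x = f a" "y = f b" "z = f c"
        using repr x y z by metis
      then show "x \<oplus>\<^bsub>N\<^esub> y \<in> carrier N"
        by (simp add: hom mod_homD(1)[OF f])
      from * show "x \<oplus>\<^bsub>N\<^esub> y \<oplus>\<^bsub>N\<^esub> z = x \<oplus>\<^bsub>N\<^esub> (y \<oplus>\<^bsub>N\<^esub> z)"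
        by (simp add: hom M.a_assoc)
      from * show "x \<oplus>\<^bsub>N\<^esub> y = y \<oplus>\<^bsub>N\<^esub> x"
        by (simp add: hom M.a_comm)
    next
      fix x assume x: "x \<in> carrier N"
      then obtain a where *: "a \<in> carrier M" "x = f a"
        using repr by metis
      then show "\<zero>\<^bsub>N\<^esub> \<oplus>\<^bsub>N\<^esub> x = x"
        by (simp add: hom flip: zero)
      from * show "\<exists>y\<in>carrier N. y \<oplus>\<^bsub>N\<^esub> x = \<zero>\<^bsub>N\<^esub>"
        by (intro bexI[of _ "f (\<ominus>\<^bsub>M\<^esub> a)"])
          (simp_all add: hom mod_homD(1)[OF f] M.l_neg flip: zero)
    qed
  next
    fix r x assume "r \<in> carrier R" "x \<in> carrier N"
    then show "r \<odot>\<^bsub>N\<^esub> x \<in> carrier N"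
      using repr by (fastforce simp: hom mod_homD(1)[OF f])
  next
    fix r s x assume rs: "r \<in> carrier R" "s \<in> carrier R" and "x \<in> carrier N"
    then obtain a where *: "a \<in> carrier M" "x = f a"
      using repr by metis
    with rs show "(r \<oplus>\<^bsub>R\<^esub> s) \<odot>\<^bsub>N\<^esub> x = r \<odot>\<^bsub>N\<^esub> x \<oplus>\<^bsub>N\<^esub> s \<odot>\<^bsub>N\<^esub> x"
      by (simp add: hom M.smult_l_distr)
    from * rs show "(r \<otimes>\<^bsub>R\<^esub> s) \<odot>\<^bsub>N\<^esub> x = r \<odot>\<^bsub>N\<^esub> (s \<odot>\<^bsub>N\<^esub> x)"
      by (simp add: hom M.smult_assoc1)
  next
    fix r x y assume r: "r \<in> carrier R" and "x \<in> carrier N" "y \<in> carrier N"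
    then obtain a b where "a \<in> carrier M" "b \<in> carrier M" "x = f a" "y = f b"
      using repr by metis
    with r show "r \<odot>\<^bsub>N\<^esub> (x \<oplus>\<^bsub>N\<^esub> y) = r \<odot>\<^bsub>N\<^esub> x \<oplus>\<^bsub>N\<^esub> r \<odot>\<^bsub>N\<^esub> y"
      by (simp add: hom M.smult_r_distr)
  next
    fix x assume "x \<in> carrier N"
    then show "\<one>\<^bsub>R\<^esub> \<odot>\<^bsub>N\<^esub> x = x"
      using repr by (fastforce simp: hom)
  qed
qed

section \<open>The regular module, quotients and direct sums\<close>

lemma regular_module_simps [simp]:
  "carrier (regular_module R) = carrier R"
  "(\<oplus>\<^bsub>regular_module R\<^esub>) = (\<oplus>\<^bsub>R\<^esub>)"
  "\<zero>\<^bsub>regular_module R\<^esub> = \<zero>\<^bsub>R\<^esub>"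
  "(\<odot>\<^bsub>regular_module R\<^esub>) = (\<otimes>\<^bsub>R\<^esub>)"
  by (simp_all add: regular_module_def)

lemma a_inv_regular_module [simp]: "a_inv (regular_module R) = a_inv R"
  by (rule ext) (simp add: a_inv_def m_inv_def)

lemma a_r_coset_regular_module [simp]: "a_r_coset (regular_module R) = a_r_coset R"
  by (intro ext) (simp add: a_r_coset_def')

lemma module_regular:
  assumes "cring R"
  shows "module R (regular_module R)"
proof -
  interpret cring R by fact
  show ?thesis
    by (rule moduleI)
      (auto intro!: abelian_groupI bexI[where x = "\<ominus>\<^bsub>R\<^esub> _"] cring_axioms
        simp: a_assoc a_comm a_lcomm l_distr r_distr m_assoc r_neg)
qed

lemma ideal_submodule_regular:
  assumes "cring R" "ideal I R"
  shows "submodule I R (regular_module R)"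
proof -
  interpret ideal I R by fact
  interpret M: module R "regular_module R"
    using assms(1) by (rule module_regular)
  show ?thesis
    by (rule M.submoduleI) (use a_subset I_l_closed in auto)
qed

lemma zero_module_simps [simp]:
  "carrier zero_module = {()}"
  "\<zero>\<^bsub>zero_module\<^esub> = ()"
  by (simp_all add: zero_module_def)

lemma module_zero_module:
  assumes "cring R"
  shows "module R zero_module"
  using assms by (auto intro!: moduleI abelian_groupI simp: zero_module_def)

lemma abelian_subgroup_of_submodule:
  assumes "module R M" "submodule N R M"
  shows "abelian_subgroup N M"
  using assms
  by (auto intro!: abelian_subgroupI3 additive_subgroupI dest: submodule.axioms module.axioms)

text \<open>All representatives \<open>n + x\<close> of a coset give the same product, because \<open>r n\<close> stays in
  the submodule; hence the union that defines the scalar action is a single coset.\<close>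

lemma quotient_module_smult:
  assumes M: "module R M" and N: "submodule N R M"
    and r: "r \<in> carrier R" and x: "x \<in> carrier M"
  shows "r \<odot>\<^bsub>quotient_module M N\<^esub> (N +>\<^bsub>M\<^esub> x) = N +>\<^bsub>M\<^esub> (r \<odot>\<^bsub>M\<^esub> x)"
proof -
  interpret M: module R M by fact
  interpret abelian_subgroup N M
    using M N by (rule abelian_subgroup_of_submodule)
  have coset: "N +>\<^bsub>M\<^esub> (r \<odot>\<^bsub>M\<^esub> y) = N +>\<^bsub>M\<^esub> (r \<odot>\<^bsub>M\<^esub> x)" if y: "y \<in> N +>\<^bsub>M\<^esub> x" for y
  proof -
    obtain n where n: "n \<in> N" "y = n \<oplus>\<^bsub>M\<^esub> x"
      using y by (auto simp: a_r_coset_def')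
    have "r \<odot>\<^bsub>M\<^esub> y = r \<odot>\<^bsub>M\<^esub> n \<oplus>\<^bsub>M\<^esub> r \<odot>\<^bsub>M\<^esub> x"
      using n r x by (simp add: M.smult_r_distr)
    moreover have "r \<odot>\<^bsub>M\<^esub> n \<in> N"
      using M.submoduleE(4)[OF N] r n by simp
    ultimately have "r \<odot>\<^bsub>M\<^esub> y \<in> N +>\<^bsub>M\<^esub> (r \<odot>\<^bsub>M\<^esub> x)"
      by (auto simp: a_r_coset_def')
    then show ?thesis
      using a_repr_independence' r x by auto
  qed
  have "r \<odot>\<^bsub>quotient_module M N\<^esub> (N +>\<^bsub>M\<^esub> x) = (\<Union>y \<in> N +>\<^bsub>M\<^esub> x. N +>\<^bsub>M\<^esub> (r \<odot>\<^bsub>M\<^esub> y))"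
    by (simp add: quotient_module_def)
  also have "\<dots> = (\<Union>y \<in> N +>\<^bsub>M\<^esub> x. N +>\<^bsub>M\<^esub> (r \<odot>\<^bsub>M\<^esub> x))"
    by (rule SUP_cong[OF refl]) (rule coset)
  also have "\<dots> = N +>\<^bsub>M\<^esub> (r \<odot>\<^bsub>M\<^esub> x)"
    using a_rcos_self[OF x] by (subst UN_constant) auto
  finally show ?thesis .
qed

lemma quotient_map_mod_hom:
  assumes M: "module R M" and N: "submodule N R M"
  shows "(\<lambda>x. N +>\<^bsub>M\<^esub> x) \<in> mod_hom R M (quotient_module M N)"
proof -
  interpret M: module R M by fact
  interpret abelian_subgroup N M
    using M N by (rule abelian_subgroup_of_submodule)
  show ?thesis
  proof (rule mod_homI)
    fix x assume "x \<in> carrier M"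
    then show "N +>\<^bsub>M\<^esub> x \<in> carrier (quotient_module M N)"
      using M.a_rcosetsI[OF a_subset] by (simp add: quotient_module_def)
  next
    fix x y assume "x \<in> carrier M" "y \<in> carrier M"
    then show "N +>\<^bsub>M\<^esub> (x \<oplus>\<^bsub>M\<^esub> y) = (N +>\<^bsub>M\<^esub> x) \<oplus>\<^bsub>quotient_module M N\<^esub> (N +>\<^bsub>M\<^esub> y)"
      by (simp add: quotient_module_def a_rcos_sum)
  qed (simp add: quotient_module_smult[OF M N])
qed

lemma quotient_map_surj:
  "(\<lambda>x. N +>\<^bsub>M\<^esub> x) ` carrier M = carrier (quotient_module M N)"
  by (auto simp: quotient_module_def A_RCOSETS_def')

lemma quotient_map_kernel:
  assumes M: "module R M" and N: "submodule N R M"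
  shows "a_kernel M (quotient_module M N) (\<lambda>x. N +>\<^bsub>M\<^esub> x) = N"
proof -
  interpret M: module R M by fact
  interpret abelian_subgroup N M
    using M N by (rule abelian_subgroup_of_submodule)
  show ?thesis
    using a_rcos_const a_rcos_self
    by (auto simp: a_kernel_def' quotient_module_def)
qed

lemma module_quotient:
  assumes M: "module R M" and N: "submodule N R M"
  shows "module R (quotient_module M N)"
proof (rule module_of_surjection[OF M quotient_map_surj])
  interpret M: module R M by fact
  show "N +>\<^bsub>M\<^esub> \<zero>\<^bsub>M\<^esub> = \<zero>\<^bsub>quotient_module M N\<^esub>"
    using M.submoduleE(1)[OF N] by (simp add: quotient_module_def)
  show "(\<lambda>x. N +>\<^bsub>M\<^esub> x) \<in> mod_hom R M (quotient_module M N)"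
    using assms by (rule quotient_map_mod_hom)
qed

lemma module_direct_sum:
  assumes R: "cring R" and M: "\<And>i. i \<in> I \<Longrightarrow> module R (M i)"
  shows "module R (direct_sum_module I M)"
proof -
  let ?S = "direct_sum_module I M"
  let ?supp = "\<lambda>x. {i \<in> I. x i \<noteq> \<zero>\<^bsub>M i\<^esub>}"
  have grp: "abelian_group (M i)" if "i \<in> I" for i
    using M[OF that] by (rule module.axioms)
  note mon = abelian_group.axioms(1)[OF grp]
  have carrier: "x \<in> carrier ?S \<longleftrightarrow>
      x \<in> extensional I \<and> (\<forall>i\<in>I. x i \<in> carrier (M i)) \<and> finite (?supp x)" for x
    by (auto simp: direct_sum_module_def PiE_iff)
  have ops: "\<zero>\<^bsub>?S\<^esub> = (\<lambda>i\<in>I. \<zero>\<^bsub>M i\<^esub>)" "x \<oplus>\<^bsub>?S\<^esub> y = (\<lambda>i\<in>I. x i \<oplus>\<^bsub>M i\<^esub> y i)"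
    "r \<odot>\<^bsub>?S\<^esub> x = (\<lambda>i\<in>I. r \<odot>\<^bsub>M i\<^esub> x i)" for r x y
    by (simp_all add: direct_sum_module_def)
  have smult_closed: "r \<odot>\<^bsub>?S\<^esub> x \<in> carrier ?S" if "r \<in> carrier R" "x \<in> carrier ?S" for r x
  proof -
    have "?supp (r \<odot>\<^bsub>?S\<^esub> x) \<subseteq> ?supp x"
      using that by (auto simp: ops module.smult_r_null[OF M])
    moreover have "finite (?supp x)"
      using that by (simp add: carrier)
    ultimately have "finite (?supp (r \<odot>\<^bsub>?S\<^esub> x))"
      by (rule finite_subset)
    with that show ?thesis
      by (simp add: carrier ops module.smult_closed[OF M])
  qed
  show ?thesis
  proof (rule moduleI)
    show "abelian_group ?S"
    proof (rule abelian_groupI)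
      fix x y assume xy: "x \<in> carrier ?S" "y \<in> carrier ?S"
      have "?supp (x \<oplus>\<^bsub>?S\<^esub> y) \<subseteq> ?supp x \<union> ?supp y"
        by (auto simp: ops abelian_monoid.l_zero[OF mon] abelian_monoid.zero_closed[OF mon])
      moreover have "finite (?supp x \<union> ?supp y)"
        using xy by (simp add: carrier)
      ultimately have "finite (?supp (x \<oplus>\<^bsub>?S\<^esub> y))"
        by (rule finite_subset)
      with xy show "x \<oplus>\<^bsub>?S\<^esub> y \<in> carrier ?S"
        by (simp add: carrier ops abelian_monoid.a_closed[OF mon])
      from xy show "x \<oplus>\<^bsub>?S\<^esub> y = y \<oplus>\<^bsub>?S\<^esub> x"
        by (simp add: carrier ops abelian_monoid.a_comm[OF mon] cong: restrict_cong)
    next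
      fix x y z assume "x \<in> carrier ?S" "y \<in> carrier ?S" "z \<in> carrier ?S"
      then show "x \<oplus>\<^bsub>?S\<^esub> y \<oplus>\<^bsub>?S\<^esub> z = x \<oplus>\<^bsub>?S\<^esub> (y \<oplus>\<^bsub>?S\<^esub> z)"
        by (simp add: carrier ops abelian_monoid.a_assoc[OF mon] cong: restrict_cong)
    next
      fix x assume x: "x \<in> carrier ?S"
      then show "\<zero>\<^bsub>?S\<^esub> \<oplus>\<^bsub>?S\<^esub> x = x"
        by (auto simp: carrier ops abelian_monoid.l_zero[OF mon] extensional_def fun_eq_iff)
      have one: "\<ominus>\<^bsub>R\<^esub> \<one>\<^bsub>R\<^esub> \<in> carrier R"
        using R by (simp add: cring.axioms(1) ring.is_abelian_group abelian_group.a_inv_closed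
            ring.ring_simprules(6))
      show "\<exists>y\<in>carrier ?S. y \<oplus>\<^bsub>?S\<^esub> x = \<zero>\<^bsub>?S\<^esub>"
      proof (rule bexI)
        \<comment> \<open>The negative is taken as \<open>(- 1) x\<close>: finiteness of its support is then part of the
          closure under scalars.\<close>
        show "(\<ominus>\<^bsub>R\<^esub> \<one>\<^bsub>R\<^esub>) \<odot>\<^bsub>?S\<^esub> x \<in> carrier ?S"
          using one x by (rule smult_closed)
        have "(\<ominus>\<^bsub>R\<^esub> \<one>\<^bsub>R\<^esub>) \<odot>\<^bsub>M i\<^esub> x i \<oplus>\<^bsub>M i\<^esub> x i = \<zero>\<^bsub>M i\<^esub>" if i: "i \<in> I" for i
        proof -
          interpret module R "M i" using i by (rule M)
          have "x i \<in> carrier (M i)"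
            using x i by (simp add: carrier)
          then show ?thesis
            by (simp add: smult_l_minus M.l_neg)
        qed
        then show "(\<ominus>\<^bsub>R\<^esub> \<one>\<^bsub>R\<^esub>) \<odot>\<^bsub>?S\<^esub> x \<oplus>\<^bsub>?S\<^esub> x = \<zero>\<^bsub>?S\<^esub>"
          by (simp add: ops cong: restrict_cong)
      qed
    qed (simp add: carrier ops abelian_monoid.zero_closed[OF mon])
  next
    fix x assume "x \<in> carrier ?S"
    then show "\<one>\<^bsub>R\<^esub> \<odot>\<^bsub>?S\<^esub> x = x"
      by (auto simp: carrier ops module.smult_one[OF M] extensional_def fun_eq_iff)
  qed (use R in \<open>simp_all add: smult_closed, simp_all add: carrier ops
      module.smult_l_distr[OF M] module.smult_r_distr[OF M] module.smult_assoc1[OF M]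
      cong: restrict_cong\<close>)
qed

lemma direct_sum_coordinate_mod_hom:
  assumes "i \<in> I"
  shows "(\<lambda>x. x i) \<in> mod_hom R (direct_sum_module I M) (M i)"
  using assms by (auto simp: mod_hom_def direct_sum_module_def)

text \<open>For finite \<open>I\<close> every family has finite support, so the direct sum is also the product and
  receives a map for each family of maps to the summands.\<close>

lemma mod_hom_into_direct_sum:
  assumes "finite I" and f: "\<And>i. i \<in> I \<Longrightarrow> f i \<in> mod_hom R L (M i)"
  shows "(\<lambda>x. \<lambda>i\<in>I. f i x) \<in> mod_hom R L (direct_sum_module I M)"
proof (rule mod_homI)
  fix x assume "x \<in> carrier L"
  then show "(\<lambda>i\<in>I. f i x) \<in> carrier (direct_sum_module I M)"
    using \<open>finite I\<close> by (auto simp: direct_sum_module_def mod_homD(1)[OF f])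
qed (auto simp: direct_sum_module_def mod_homD(2,3)[OF f] cong: restrict_cong)

section \<open>Two short exact sequences\<close>

lemma a_kernel_unit: "a_kernel C Z (\<lambda>_. ()) = carrier C"
  by (simp add: a_kernel_def')

lemma short_exact_seqI:
  assumes A: "module R A" and B: "module R B" and C: "module R C"
    and f: "f \<in> mod_hom R A B" and g: "g \<in> mod_hom R B C"
    and inj: "a_kernel A B f = {\<zero>\<^bsub>A\<^esub>}"
    and middle: "f ` carrier A = a_kernel B C g"
    and surj: "g ` carrier B = carrier C"
  shows "short_exact_seq R A f B g C"
proof -
  interpret A: module R A by fact
  have zero: "module R zero_module"
    by (rule module_zero_module) (rule A.R.cring_axioms)
  have "(\<lambda>_. \<zero>\<^bsub>A\<^esub>) \<in> mod_hom R zero_module A"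
    by (rule mod_homI) auto
  moreover have "(\<lambda>_. ()) \<in> mod_hom R C zero_module"
    by (rule mod_homI) auto
  ultimately show ?thesis
    unfolding short_exact_seq_def exact_at_def
    using assms zero by (simp add: a_kernel_unit)
qed

text \<open>Exactness in the middle holds because \<open>N\<close> and the image of \<open>f\<close> have the same zero, so
  regarding \<open>f\<close> as a map to either of them gives the same kernel.\<close>

lemma short_exact_seq_kernel_image:
  assumes M: "module R M" and N: "module R N" and f: "f \<in> mod_hom R M N"
  shows "short_exact_seq R (M\<lparr>carrier := a_kernel M N f\<rparr>) (\<lambda>x. x) M
           f (N\<lparr>carrier := f ` carrier M\<rparr>)"
proof (rule short_exact_seqI)
  note K = submodule_kernel[OF assms]
  show "module R (M\<lparr>carrier := a_kernel M N f\<rparr>)"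
    by (rule submodule.submodule_is_module[OF K M])
  show "module R (N\<lparr>carrier := f ` carrier M\<rparr>)"
    by (rule submodule.submodule_is_module[OF submodule_image[OF assms] N])
  show "(\<lambda>x. x) \<in> mod_hom R (M\<lparr>carrier := a_kernel M N f\<rparr>) M"
    by (auto simp: mod_hom_def a_kernel_def')
  show "f \<in> mod_hom R M (N\<lparr>carrier := f ` carrier M\<rparr>)"
    using f by (auto simp: mod_hom_def)
  have "\<zero>\<^bsub>M\<^esub> \<in> a_kernel M N f"
    using subgroup.one_closed[OF submodule.axioms(1)[OF K]] by simp
  then show "a_kernel (M\<lparr>carrier := a_kernel M N f\<rparr>) M (\<lambda>x. x) = {\<zero>\<^bsub>M\<lparr>carrier := a_kernel M N f\<rparr>\<^esub>}"
    by (auto simp: a_kernel_def')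
  show "(\<lambda>x. x) ` carrier (M\<lparr>carrier := a_kernel M N f\<rparr>) =
      a_kernel M (N\<lparr>carrier := f ` carrier M\<rparr>) f"
    by (simp add: a_kernel_def')
  show "module R M"
    by (rule M)
  show "f ` carrier M = carrier (N\<lparr>carrier := f ` carrier M\<rparr>)"
    by simp
qed

lemma short_exact_seq_quotient:
  assumes M: "module R M" and N: "submodule N R M"
  shows "short_exact_seq R (M\<lparr>carrier := N\<rparr>) (\<lambda>x. x) M
           (\<lambda>x. N +>\<^bsub>M\<^esub> x) (quotient_module M N)"
proof (rule short_exact_seqI)
  interpret M: module R M by fact
  show "module R (M\<lparr>carrier := N\<rparr>)"
    by (rule submodule.submodule_is_module[OF N M])
  show "(\<lambda>x. x) \<in> mod_hom R (M\<lparr>carrier := N\<rparr>) M"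
    using M.submoduleE(1)[OF N] by (auto simp: mod_hom_def)
  have "\<zero>\<^bsub>M\<^esub> \<in> N"
    using subgroup.one_closed[OF submodule.axioms(1)[OF N]] by simp
  then show "a_kernel (M\<lparr>carrier := N\<rparr>) M (\<lambda>x. x) = {\<zero>\<^bsub>M\<lparr>carrier := N\<rparr>\<^esub>}"
    by (auto simp: a_kernel_def')
qed (use assms in \<open>simp_all add: module_quotient quotient_map_mod_hom quotient_map_surj
    quotient_map_kernel\<close>)

section \<open>The potential morphism\<close>

context edge_labeled_graph
begin

lemma module_vertex_module: "module R (vertex_module R G)"
  unfolding vertex_module_def
  by (intro module_direct_sum module_regular R.cring_axioms)

lemma module_edge_module: "module R (edge_module R G \<alpha>)"
  unfolding edge_module_def
  by (intro module_direct_sum module_quotient module_regular ideal_submodule_regular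
      label_ideal R.cring_axioms)

lemma difference_mod_hom:
  assumes "u \<in> verts G" "v \<in> verts G"
  shows "(\<lambda>r. r u \<ominus> r v) \<in> mod_hom R (vertex_module R G) (regular_module R)"
proof -
  have coordinate: "(\<lambda>r. r w) \<in> mod_hom R (vertex_module R G) (regular_module R)"
    if "w \<in> verts G" for w
    unfolding vertex_module_def using that by (rule direct_sum_coordinate_mod_hom)
  note u = mod_homD[OF coordinate[OF assms(1)]] and v = mod_homD[OF coordinate[OF assms(2)]]
  show ?thesis
  proof (rule mod_homI)
    fix x y assume "x \<in> carrier (vertex_module R G)" "y \<in> carrier (vertex_module R G)"
    then show "(x \<oplus>\<^bsub>vertex_module R G\<^esub> y) u \<ominus> (x \<oplus>\<^bsub>vertex_module R G\<^esub> y) v =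
        (x u \<ominus> x v) \<oplus>\<^bsub>regular_module R\<^esub> (y u \<ominus> y v)"
      using u(1) v(1) by (simp add: u(2) v(2) R.minus_eq R.minus_add R.a_ac)
  next
    fix r x assume "r \<in> carrier R" "x \<in> carrier (vertex_module R G)"
    then show "(r \<odot>\<^bsub>vertex_module R G\<^esub> x) u \<ominus> (r \<odot>\<^bsub>vertex_module R G\<^esub> x) v =
        r \<odot>\<^bsub>regular_module R\<^esub> (x u \<ominus> x v)"
      using u(1) v(1) by (simp add: u(3) v(3) R.minus_eq R.r_distr R.r_minus)
  qed (use u(1) v(1) in simp)
qed

lemma potential_mod_hom:
  "potential R G \<alpha> \<in> mod_hom R (vertex_module R G) (edge_module R G \<alpha>)"
proof -
  have "(\<lambda>r. \<alpha> e +> (r (tail G e) \<ominus> r (head G e)))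
      \<in> mod_hom R (vertex_module R G) (quotient_module (regular_module R) (\<alpha> e))"
    if e: "e \<in> arcs G" for e
  proof -
    have difference: "(\<lambda>r. r (tail G e) \<ominus> r (head G e))
        \<in> mod_hom R (vertex_module R G) (regular_module R)"
      using e by (intro difference_mod_hom) auto
    have "submodule (\<alpha> e) R (regular_module R)"
      by (intro ideal_submodule_regular R.cring_axioms label_ideal e)
    from quotient_map_mod_hom[OF module_regular[OF R.cring_axioms] this]
    have "(\<lambda>a. \<alpha> e +> a) \<in> mod_hom R (regular_module R)
        (quotient_module (regular_module R) (\<alpha> e))"
      by simp
    with difference show ?thesis
      by (rule mod_hom_comp)
  qed
  then have "(\<lambda>r. \<lambda>e\<in>arcs G. \<alpha> e +> (r (tail G e) \<ominus> r (head G e)))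
      \<in> mod_hom R (vertex_module R G) (edge_module R G \<alpha>)"
    unfolding edge_module_def by (intro mod_hom_into_direct_sum finite_arcs)
  then show ?thesis
    by (simp add: potential_def[abs_def])
qed

end

theorem lemma3p2:
  fixes R :: "('a, 'm) ring_scheme"
    and G :: "('v, 'e) pre_digraph"
    and \<alpha> :: "'e \<Rightarrow> 'a set"
  assumes "edge_labeled_graph R G \<alpha>"
  shows "short_exact_seq R
           (spline_module R G \<alpha>) (\<lambda>x. x)
           (vertex_module R G) (potential R G \<alpha>)
           (cospline_module R G \<alpha>) \<and>
         short_exact_seq R
           (cospline_module R G \<alpha>) (\<lambda>y. y)
           (edge_module R G \<alpha>) (copotential R G \<alpha>)
           (failed_cospline_module R G \<alpha>)"
proof
  interpret edge_labeled_graph R G \<alpha> by fact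
  note hom = module_vertex_module module_edge_module potential_mod_hom
  show "short_exact_seq R (spline_module R G \<alpha>) (\<lambda>x. x) (vertex_module R G)
      (potential R G \<alpha>) (cospline_module R G \<alpha>)"
    unfolding spline_module_def cospline_module_def
    by (rule short_exact_seq_kernel_image[OF hom])
  show "short_exact_seq R (cospline_module R G \<alpha>) (\<lambda>y. y) (edge_module R G \<alpha>)
      (copotential R G \<alpha>) (failed_cospline_module R G \<alpha>)"
    using short_exact_seq_quotient[OF module_edge_module submodule_image[OF hom]]
    by (simp add: cospline_module_def failed_cospline_module_def copotential_def[abs_def])
qed

end
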